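(* For any strongly regular graph $X$ and any edge $e$ of $X$, the eigenvalues (with multiplicity) of the graph obtained from $X$ by deleting the edge $e$ do not depend on the choice of $e$. Similarly, if $u,v$ are distinct non-adjacent vertices of $X$, the eigenvalues (with multiplicity) of the graph obtained from $X$ by adding an edge joining $u$ and $v$ do not depend on the choice of the non-adjacent pair $u,v$.
   Context: A strongly regular graph with parameters $(n,k,a,c)$ is a graph on $n$ vertices, neither empty nor complete, in which every vertex has degree $k$, every two adjacent vertices have $a$ common neighbours, and every two distinct non-adjacent vertices have $c$ common neighbours. The eigenvalues of a graph are those of its adjacency matrix. *)

theory Defs
  imports
    "Graph_Theory.Kuratowski"
    "Jordan_Normal_Form.Char_Poly"
    "HOL-Computational_Algebra.Fundamental_Theorem_Algebra"
begin

text \<open>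
  A finite simple graph is a \<^locale>\<open>pair_graph\<close>: a finite, loop-free digraph whose arc set is
  symmetric, so an undirected edge between \<open>u\<close> and \<open>v\<close> is the pair of arcs
  \<open>(u, v)\<close>, \<open>(v, u)\<close>.
\<close>

definition common_neighbours :: "'a pair_pre_digraph \<Rightarrow> 'a \<Rightarrow> 'a \<Rightarrow> 'a set" where
  "common_neighbours G u v = {w \<in> pverts G. (u, w) \<in> parcs G \<and> (v, w) \<in> parcs G}"

definition strongly_regular ::
    "nat \<Rightarrow> nat \<Rightarrow> nat \<Rightarrow> nat \<Rightarrow> 'a pair_pre_digraph \<Rightarrow> bool" where
  "strongly_regular n k a c G \<longleftrightarrow>
     pair_graph G \<and> card (pverts G) = n \<and>
     parcs G \<noteq> {} \<and> \<not> complete_digraph n (with_proj G) \<and>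
     (\<forall>u \<in> pverts G. out_degree (with_proj G) u = k) \<and>
     (\<forall>u \<in> pverts G. \<forall>v \<in> pverts G. (u, v) \<in> parcs G \<longrightarrow>
        card (common_neighbours G u v) = a) \<and>
     (\<forall>u \<in> pverts G. \<forall>v \<in> pverts G. u \<noteq> v \<and> (u, v) \<notin> parcs G \<longrightarrow>
        card (common_neighbours G u v) = c)"

definition delete_edge :: "'a \<Rightarrow> 'a \<Rightarrow> 'a pair_pre_digraph \<Rightarrow> 'a pair_pre_digraph" where
  "delete_edge u v G = G\<lparr>parcs := parcs G - {(u, v), (v, u)}\<rparr>"

definition add_edge :: "'a \<Rightarrow> 'a \<Rightarrow> 'a pair_pre_digraph \<Rightarrow> 'a pair_pre_digraph" where
  "add_edge u v G = G\<lparr>parcs := parcs G \<union> {(u, v), (v, u)}\<rparr>"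

lemma pair_graph_delete_edge:
  assumes "pair_graph G"
  shows "pair_graph (delete_edge u v G)"
proof -
  interpret pair_graph G by fact
  have "sym (parcs G)" using pair_sym_arcs by (simp add: symmetric_def)
  then have "sym (parcs G - {(u, v), (v, u)})" by (auto simp: sym_def)
  then show ?thesis
    by unfold_locales
       (use no_loops in \<open>auto simp: delete_edge_def symmetric_def dest: in_arcsD1 in_arcsD2\<close>)
qed

lemma pair_graph_add_edge:
  assumes "pair_graph G" "u \<in> pverts G" "v \<in> pverts G" "u \<noteq> v"
  shows "pair_graph (add_edge u v G)"
proof -
  interpret pair_graph G by fact
  have "sym (parcs G)" using pair_sym_arcs by (simp add: symmetric_def)
  then have "sym (parcs G \<union> {(u, v), (v, u)})" by (auto simp: sym_def)
  then show ?thesis using assms(2-4)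
    by unfold_locales
       (use no_loops in \<open>auto simp: add_edge_def symmetric_def dest: in_arcsD1 in_arcsD2\<close>)
qed

text \<open>
  Matrices are indexed by numbers, so the adjacency matrix is taken with respect to an
  enumeration of the vertices.
\<close>

definition vertex_enum :: "'a pair_pre_digraph \<Rightarrow> 'a list \<Rightarrow> bool" where
  "vertex_enum G vs \<longleftrightarrow> distinct vs \<and> set vs = pverts G"

definition adjacency_mat :: "'a pair_pre_digraph \<Rightarrow> 'a list \<Rightarrow> complex mat" where
  "adjacency_mat G vs =
     mat (length vs) (length vs) (\<lambda>(i, j). if (vs ! i, vs ! j) \<in> parcs G then 1 else 0)"

text \<open>
  The multiset of eigenvalues: each eigenvalue occurs with its multiplicity as a root of the
  characteristic polynomial. The enumeration chosen is immaterial, and every eigenvalue of the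
  adjacency matrix is listed; see the lemmas below. Complex entries ensure that the multiset has
  as many elements as there are vertices; the matrix being real symmetric, all of them are in fact
  real, and algebraic and geometric multiplicities agree.
\<close>

definition graph_eigenvalues :: "'a pair_pre_digraph \<Rightarrow> complex multiset" where
  "graph_eigenvalues G = proots (char_poly (adjacency_mat G (SOME vs. vertex_enum G vs)))"

lemma adjacency_mat_carrier: "adjacency_mat G vs \<in> carrier_mat (length vs) (length vs)"
  by (simp add: adjacency_mat_def)

lemma similar_adjacency_mat:
  assumes vs: "vertex_enum G vs" and ws: "vertex_enum G ws"
  shows "similar_mat (adjacency_mat G vs) (adjacency_mat G ws)"
proof -
  define n where "n = length vs"
  have dvs: "distinct vs" and dws: "distinct ws" and seq: "set vs = set ws"
    using vs ws by (auto simp: vertex_enum_def)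
  have lws: "length ws = n"
    using dvs dws seq by (metis n_def distinct_card)
  have "\<forall>i. \<exists>j. i < n \<longrightarrow> j < n \<and> ws ! j = vs ! i"
    using seq lws n_def by (metis in_set_conv_nth nth_mem)
  then obtain f where f: "\<And>i. i < n \<Longrightarrow> f i < n \<and> ws ! f i = vs ! i" by metis
  have "\<forall>j. \<exists>i. j < n \<longrightarrow> i < n \<and> vs ! i = ws ! j"
    using seq lws n_def by (metis in_set_conv_nth nth_mem)
  then obtain g where g: "\<And>j. j < n \<Longrightarrow> g j < n \<and> vs ! g j = ws ! j" by metis
  have fg: "f i = j \<longleftrightarrow> i = g j" if "i < n" "j < n" for i j
    using f[OF that(1)] g[OF that(2)] that dvs dws lws n_def by (metis nth_eq_iff_index_eq)
  define P :: "complex mat" where "P = mat n n (\<lambda>(i, j). if j = f i then 1 else 0)"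
  define Q :: "complex mat" where "Q = mat n n (\<lambda>(i, j). if j = g i then 1 else 0)"
  define A where "A = adjacency_mat G vs"
  define B where "B = adjacency_mat G ws"
  have cA: "A \<in> carrier_mat n n" and cB: "B \<in> carrier_mat n n"
    using adjacency_mat_carrier[of G vs] adjacency_mat_carrier[of G ws]
    by (simp_all add: A_def B_def n_def[symmetric] lws)
  have cP: "P \<in> carrier_mat n n" and cQ: "Q \<in> carrier_mat n n"
    by (simp_all add: P_def Q_def)
  have P_left: "(P * M) $$ (i, j) = M $$ (f i, j)"
    if "M \<in> carrier_mat n n" "i < n" "j < n" for M i j
  proof -
    have "(P * M) $$ (i, j) = (\<Sum>l = 0..<n. (if l = f i then 1 else 0) * M $$ (l, j))"
      using that by (simp add: P_def scalar_prod_def)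
    also have "\<dots> = (\<Sum>l = 0..<n. if l = f i then M $$ (l, j) else 0)"
      by (rule sum.cong) auto
    also have "\<dots> = M $$ (f i, j)" using f[OF that(2)] by simp
    finally show ?thesis .
  qed
  have Q_left: "(Q * M) $$ (i, j) = M $$ (g i, j)"
    if "M \<in> carrier_mat n n" "i < n" "j < n" for M i j
  proof -
    have "(Q * M) $$ (i, j) = (\<Sum>l = 0..<n. (if l = g i then 1 else 0) * M $$ (l, j))"
      using that by (simp add: Q_def scalar_prod_def)
    also have "\<dots> = (\<Sum>l = 0..<n. if l = g i then M $$ (l, j) else 0)"
      by (rule sum.cong) auto
    also have "\<dots> = M $$ (g i, j)" using g[OF that(2)] by simp
    finally show ?thesis .
  qed
  have Q_right: "(M * Q) $$ (i, j) = M $$ (i, f j)"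
    if "M \<in> carrier_mat n n" "i < n" "j < n" for M i j
  proof -
    have "(M * Q) $$ (i, j) = (\<Sum>l = 0..<n. M $$ (i, l) * (if j = g l then 1 else 0))"
      using that by (simp add: Q_def scalar_prod_def)
    also have "\<dots> = (\<Sum>l = 0..<n. if l = f j then M $$ (i, l) else 0)"
    proof (rule sum.cong)
      fix l assume "l \<in> {0..<n}"
      then have "j = g l \<longleftrightarrow> l = f j" using fg[OF that(3), of l] by auto
      then show "M $$ (i, l) * (if j = g l then 1 else 0) = (if l = f j then M $$ (i, l) else 0)"
        by (cases "l = f j") simp_all
    qed simp
    also have "\<dots> = M $$ (i, f j)" using f[OF that(3)] by simp
    finally show ?thesis .
  qed
  have PQ: "P * Q = 1\<^sub>m n"
  proof (rule eq_matI)
    fix i j assume ij: "i < dim_row (1\<^sub>m n :: complex mat)" "j < dim_col (1\<^sub>m n :: complex mat)"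
    then have i: "i < n" and j: "j < n" by auto
    have "(P * Q) $$ (i, j) = P $$ (i, f j)" using Q_right[OF cP i j] .
    also have "\<dots> = (if f j = f i then 1 else 0)" using i f[OF j] by (simp add: P_def)
    also have "(f j = f i) = (i = j)"
      using f[OF i] f[OF j] dvs i j n_def by (metis nth_eq_iff_index_eq)
    finally show "(P * Q) $$ (i, j) = 1\<^sub>m n $$ (i, j)" using i j by simp
  qed (use cP cQ in auto)
  have QP: "Q * P = 1\<^sub>m n"
  proof (rule eq_matI)
    fix i j assume ij: "i < dim_row (1\<^sub>m n :: complex mat)" "j < dim_col (1\<^sub>m n :: complex mat)"
    then have i: "i < n" and j: "j < n" by auto
    have "(Q * P) $$ (i, j) = P $$ (g i, j)" using Q_left[OF cP i j] .
    also have "\<dots> = (if j = f (g i) then 1 else 0)" using j g[OF i] by (simp add: P_def)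
    also have "f (g i) = i" using fg g[OF i] i by blast
    finally show "(Q * P) $$ (i, j) = 1\<^sub>m n $$ (i, j)" using i j by auto
  qed (use cP cQ in auto)
  have "A = P * B * Q"
  proof (rule eq_matI)
    fix i j assume "i < dim_row (P * B * Q)" "j < dim_col (P * B * Q)"
    then have i: "i < n" and j: "j < n" using cP cQ by auto
    have cPB: "P * B \<in> carrier_mat n n" using cP cB by simp
    have "(P * B * Q) $$ (i, j) = B $$ (f i, f j)"
      using Q_right[OF cPB i j] P_left[OF cB i] f[OF j] by simp
    also have "\<dots> = A $$ (i, j)"
      using f[OF i] f[OF j] i j by (simp add: A_def B_def adjacency_mat_def lws n_def[symmetric])
    finally show "A $$ (i, j) = (P * B * Q) $$ (i, j)" by simp
  qed (use cA cP cQ in auto)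
  then have "similar_mat_wit A B P Q"
    using cA cB cP cQ PQ QP by (simp add: similar_mat_wit_def Let_def)
  then show ?thesis unfolding similar_mat_def A_def B_def by blast
qed

lemma graph_eigenvalues_eq:
  assumes "vertex_enum G vs"
  shows "graph_eigenvalues G = proots (char_poly (adjacency_mat G vs))"
proof -
  have "vertex_enum G (SOME vs. vertex_enum G vs)" using assms by (rule someI)
  then show ?thesis unfolding graph_eigenvalues_def
    using char_poly_similar[OF similar_adjacency_mat[OF _ assms]] by simp
qed

lemma set_graph_eigenvalues:
  assumes "vertex_enum G vs"
  shows "set_mset (graph_eigenvalues G) = {x. eigenvalue (adjacency_mat G vs) x}"
proof -
  have "char_poly (adjacency_mat G vs) \<noteq> 0"
    using degree_monic_char_poly[OF adjacency_mat_carrier[of G vs]] by auto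
  then show ?thesis
    using eigenvalue_root_char_poly[OF adjacency_mat_carrier[of G vs]]
    by (simp add: graph_eigenvalues_eq[OF assms])
qed

lemma size_graph_eigenvalues:
  assumes "pair_graph G"
  shows "size (graph_eigenvalues G) = card (pverts G)"
proof -
  interpret pair_graph G by fact
  obtain vs where vs: "vertex_enum G vs"
    using finite_distinct_list[OF pair_finite_verts] by (auto simp: vertex_enum_def)
  then have "length vs = card (pverts G)"
    by (metis vertex_enum_def distinct_card)
  then show ?thesis
    using degree_monic_char_poly[OF adjacency_mat_carrier[of G vs]]
    by (simp add: graph_eigenvalues_eq[OF vs] size_proots_complex)
qed

end

theory Submission
  imports Defs
begin

text \<open>
  Let \<open>A\<close> be the adjacency matrix of a strongly regular graph. Counting walks of length two gives
  \<open>A\<^sup>2 = k I + a A + c (J - I - A)\<close> and \<open>A J = k J\<close>, where \<open>J\<close> is the all-ones matrix, so the span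
  of \<open>I\<close>, \<open>A\<close>, \<open>J\<close> is an algebra and the resolvent \<open>(x I - A)\<^sup>-\<^sup>1\<close> lies in it, with coefficients
  that are rational functions of \<open>x\<close> determined by \<open>k\<close>, \<open>a\<close>, \<open>c\<close>. Hence an entry of the resolvent at
  \<open>(u, v)\<close> depends only on whether \<open>u\<close> and \<open>v\<close> are equal, adjacent, or neither.

  Deleting or adding an edge between \<open>u\<close> and \<open>v\<close> changes \<open>A\<close> by a matrix supported on the
  \<open>2 \<times> 2\<close> block of these two vertices. The characteristic polynomial is then multiplied by the
  determinant of a \<open>2 \<times> 2\<close> matrix that involves only the entries of the resolvent in the same block
  (\<open>char_poly_corner_perturbation\<close>), and these agree for any two adjacent pairs, as well as for any
  two non-adjacent pairs.

  Denominators are cleared throughout: the resolvent is represented by a polynomial matrix \<open>M\<close> and a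
  polynomial \<open>d \<noteq> 0\<close> with \<open>(x I - A) M = d I\<close>
  (\<open>char_poly_matrix_times_resolvent_numer\<close>). So all identities live in the integral domain of
  polynomials, and \<open>d\<close> is cancelled only at the end. To have both pairs of vertices occupy the same
  block, each is placed at the front of its own enumeration of the vertices; the two
  unperturbed matrices are then similar.
\<close>

section \<open>Characteristic polynomials under a perturbation of a diagonal block\<close>

text \<open>
  Write \<open>K = x I - A\<close>. Since \<open>K M = d I\<close>, we have \<open>d (K - S) = K (d I - M S)\<close>, and taking
  determinants leaves \<open>det (d I - M S)\<close> to compute. As \<open>S\<close> vanishes outside its leading block, so do
  the last \<open>r\<close> columns of \<open>M S\<close>; the matrix is block lower triangular, and its determinant sees
  nothing of \<open>M\<close> but the leading block.
\<close>

lemma char_poly_corner_perturbation: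
  fixes A S :: "'a :: idom mat"
  assumes A: "A \<in> carrier_mat (m + r) (m + r)"
    and S: "S \<in> carrier_mat m m"
    and M: "M \<in> carrier_mat (m + r) (m + r)"
    and inv: "char_poly_matrix A * M = d \<cdot>\<^sub>m 1\<^sub>m (m + r)"
  shows "d ^ (m + r) * char_poly (A + four_block_mat S (0\<^sub>m m r) (0\<^sub>m r m) (0\<^sub>m r r)) =
         char_poly A * (det (d \<cdot>\<^sub>m 1\<^sub>m m - mat m m (\<lambda>ij. M $$ ij) * map_mat (\<lambda>a. [:a:]) S) * d ^ r)"
proof -
  define n where "n = m + r"
  define K where "K = char_poly_matrix A"
  define S0 where "S0 = four_block_mat S (0\<^sub>m m r) (0\<^sub>m r m) (0\<^sub>m r r)"
  define s where "s = map_mat (\<lambda>a. [:a:]) S"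
  define S1 where "S1 = four_block_mat s (0\<^sub>m m r) (0\<^sub>m r m) (0\<^sub>m r r)"
  define M1 where "M1 = mat m m (\<lambda>ij. M $$ ij)"
  define M2 where "M2 = mat m r (\<lambda>(i, j). M $$ (i, m + j))"
  define M3 where "M3 = mat r m (\<lambda>(i, j). M $$ (m + i, j))"
  define M4 where "M4 = mat r r (\<lambda>(i, j). M $$ (m + i, m + j))"
  have cA: "A \<in> carrier_mat n n" and cM: "M \<in> carrier_mat n n"
    using A M by (simp_all add: n_def)
  have cK: "K \<in> carrier_mat n n" using cA by (auto simp: K_def char_poly_matrix_def)
  have cs: "s \<in> carrier_mat m m" using S by (simp add: s_def)
  have cS1: "S1 \<in> carrier_mat n n" using cs by (simp add: S1_def n_def)
  have cMi: "M1 \<in> carrier_mat m m" "M2 \<in> carrier_mat m r" "M3 \<in> carrier_mat r m"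
    "M4 \<in> carrier_mat r r" by (simp_all add: M1_def M2_def M3_def M4_def)
  have M_blocks: "M = four_block_mat M1 M2 M3 M4"
    using M by (intro eq_matI) (auto simp: four_block_mat_def Let_def M1_def M2_def M3_def M4_def)
  have MS: "M * S1 = four_block_mat (M1 * s) (0\<^sub>m m r) (M3 * s) (0\<^sub>m r r)"
    unfolding M_blocks S1_def
    using cMi cs
    by (subst mult_four_block_mat[where ?nr1.0=m and ?n1.0=m and ?n2.0=r and ?nr2.0=r
          and ?nc1.0=m and ?nc2.0=r]) auto
  have T: "d \<cdot>\<^sub>m 1\<^sub>m n - M * S1 =
      four_block_mat (d \<cdot>\<^sub>m 1\<^sub>m m - M1 * s) (0\<^sub>m m r) (- (M3 * s)) (d \<cdot>\<^sub>m 1\<^sub>m r)"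
    unfolding MS using cMi cs
    by (intro eq_matI) (auto simp: four_block_mat_def Let_def n_def)
  have detT: "det (d \<cdot>\<^sub>m 1\<^sub>m n - M * S1) = det (d \<cdot>\<^sub>m 1\<^sub>m m - M1 * s) * d ^ r"
    unfolding T using cMi cs
    by (subst det_four_block_mat_upper_right_zero[where n=m and m=r]) auto
  have pert: "char_poly_matrix (A + S0) = K - S1"
    using cA S by (intro eq_matI)
      (auto simp: S0_def S1_def s_def K_def char_poly_matrix_def four_block_mat_def Let_def n_def)
  have "d \<cdot>\<^sub>m (K - S1) = K * (d \<cdot>\<^sub>m 1\<^sub>m n - M * S1)"
  proof -
    have "K * (d \<cdot>\<^sub>m 1\<^sub>m n - M * S1) = K * (d \<cdot>\<^sub>m 1\<^sub>m n) - K * (M * S1)"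
      using cK cM cS1 by (intro mult_minus_distrib_mat) auto
    also have "K * (d \<cdot>\<^sub>m 1\<^sub>m n) = d \<cdot>\<^sub>m K"
      using cK by (simp add: mult_smult_distrib[where n=n and nc=n])
    also have "K * (M * S1) = (K * M) * S1"
      using cK cM cS1 by (intro assoc_mult_mat[symmetric]) auto
    also have "\<dots> = d \<cdot>\<^sub>m S1"
      using cS1 inv mult_smult_assoc_mat[OF one_carrier_mat cS1, of d]
      by (simp add: K_def n_def[symmetric])
    also have "d \<cdot>\<^sub>m K - d \<cdot>\<^sub>m S1 = d \<cdot>\<^sub>m (K - S1)"
      using cK cS1 by (intro eq_matI) (auto simp: algebra_simps)
    finally show ?thesis by simp
  qed
  then have "det (d \<cdot>\<^sub>m (K - S1)) = det K * det (d \<cdot>\<^sub>m 1\<^sub>m n - M * S1)"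
    using det_mult[OF cK minus_carrier_mat[OF mult_carrier_mat[OF cM cS1]]] by simp
  moreover have "det (d \<cdot>\<^sub>m (K - S1)) = d ^ n * char_poly (A + S0)"
    using cK cS1 by (simp add: det_smult char_poly_def pert)
  ultimately show ?thesis
    unfolding detT by (simp add: K_def char_poly_def S0_def n_def M1_def s_def)
qed

section \<open>The resolvent of a strongly regular graph\<close>

text \<open>
  With \<open>M = \<alpha> I + \<beta> A + \<gamma> J\<close>, the equation \<open>(x I - A) M = d I\<close> amounts to
  \<open>d = x \<alpha> - (k - c) \<beta>\<close>, \<open>\<alpha> = (x - a + c) \<beta>\<close> and \<open>(x - k) \<gamma> = c \<beta>\<close>. The choice \<open>\<beta> = x - k\<close>, \<open>\<gamma> = c\<close>
  keeps everything polynomial. The roots of \<open>d\<close> are the degree and the two roots of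
  \<open>x\<^sup>2 - (a - c) x - (k - c)\<close>, the possible eigenvalues of the graph.
\<close>

definition resolvent_denom :: "nat \<Rightarrow> nat \<Rightarrow> nat \<Rightarrow> complex poly" where
  "resolvent_denom k a c =
     [:- of_nat k, 1:] * [:of_nat c - of_nat k, of_nat c - of_nat a, 1:]"

definition resolvent_numer ::
    "nat \<Rightarrow> nat \<Rightarrow> nat \<Rightarrow> 'a pair_pre_digraph \<Rightarrow> 'a list \<Rightarrow> complex poly mat" where
  "resolvent_numer k a c G vs = mat (length vs) (length vs) (\<lambda>(i, j).
     (if i = j then [:of_nat c - of_nat a, 1:] * [:- of_nat k, 1:] else 0) +
     (if (vs ! i, vs ! j) \<in> parcs G then [:- of_nat k, 1:] else 0) + of_nat c)"

lemma resolvent_denom_nonzero: "resolvent_denom k a c \<noteq> 0"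
  by (simp add: resolvent_denom_def del: mult_pCons_left mult_pCons_right)

lemma sum_indicator_nth:
  fixes y :: "'b :: semiring_1"
  assumes "distinct vs"
  shows "(\<Sum>l<length vs. if P (vs ! l) then y else 0) = of_nat (card {w \<in> set vs. P w}) * y"
proof -
  have "(\<Sum>l<length vs. if P (vs ! l) then y else 0) = (\<Sum>w\<in>set vs. if P w then y else 0)"
    by (rule sum.reindex_bij_betw[OF bij_betw_nth]) (use assms in auto)
  also have "\<dots> = of_nat (card {w \<in> set vs. P w}) * y"
    by (simp add: sum.If_cases Int_def)
  finally show ?thesis .
qed

lemma pair_graph_arc_commute:
  assumes "pair_graph G"
  shows "(v, u) \<in> parcs G \<longleftrightarrow> (u, v) \<in> parcs G"
proof -
  interpret pair_graph G by fact
  show ?thesis using pair_sym_arcs by (auto simp: symmetric_def sym_def)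
qed

lemma pair_graph_no_loop:
  assumes "pair_graph G"
  shows "(u, u) \<notin> parcs G"
proof -
  interpret pair_graph G by fact
  show ?thesis using no_loops[of "(u, u)"] by auto
qed

lemma card_out_neighbours:
  assumes "strongly_regular n k a c G" "u \<in> pverts G"
  shows "card {w \<in> pverts G. (u, w) \<in> parcs G} = k"
proof -
  interpret pair_graph G using assms by (simp add: strongly_regular_def)
  have "out_arcs (with_proj G) u = Pair u ` {w \<in> pverts G. (u, w) \<in> parcs G}"
    by (auto simp: out_arcs_def dest: in_arcsD2)
  then have "card (out_arcs (with_proj G) u) = card {w \<in> pverts G. (u, w) \<in> parcs G}"
    by (simp add: card_image inj_on_def)
  then show ?thesis using assms by (simp add: strongly_regular_def out_degree_def)
qed

text \<open>
  This is where strong regularity enters: it fixes the row sums of \<open>A\<close> (fact \<open>deg\<close> in the proof) and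
  the entries of \<open>A\<^sup>2\<close> (fact \<open>sq\<close>).
\<close>

lemma char_poly_matrix_times_resolvent_numer:
  assumes srg: "strongly_regular n k a c G" and vs: "vertex_enum G vs"
  shows "char_poly_matrix (adjacency_mat G vs) * resolvent_numer k a c G vs =
         resolvent_denom k a c \<cdot>\<^sub>m 1\<^sub>m (length vs)"
proof (rule eq_matI)
  let ?N = "length vs"
  define \<alpha> :: "complex poly" where "\<alpha> = [:of_nat c - of_nat a, 1:] * [:- of_nat k, 1:]"
  define \<beta> :: "complex poly" where "\<beta> = [:- of_nat k, 1:]"
  define \<gamma> :: "complex poly" where "\<gamma> = of_nat c"
  define x :: "complex poly" where "x = [:0, 1:]"
  define e where "e = (\<lambda>i j. if (vs ! i, vs ! j) \<in> parcs G then 1 else 0 :: complex poly)"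
  have G: "pair_graph G" using srg by (simp add: strongly_regular_def)
  have dist: "distinct vs" and set: "set vs = pverts G" using vs by (auto simp: vertex_enum_def)
  fix i j assume "i < dim_row (resolvent_denom k a c \<cdot>\<^sub>m 1\<^sub>m ?N)"
    "j < dim_col (resolvent_denom k a c \<cdot>\<^sub>m 1\<^sub>m ?N)"
  then have i: "i < ?N" and j: "j < ?N" by auto
  then have iv: "vs ! i \<in> pverts G" and jv: "vs ! j \<in> pverts G"
    unfolding set[symmetric] by simp_all
  have coeffs: "\<alpha> = (x - of_nat a + of_nat c) * (x - of_nat k)" "\<beta> = x - of_nat k"
    "resolvent_denom k a c = (x - of_nat k) * (x * (x - of_nat a + of_nat c) - of_nat k + of_nat c)"
    by (simp_all add: \<alpha>_def \<beta>_def x_def resolvent_denom_def of_nat_poly)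
  have no_loop: "e l l = 0" for l
    by (simp add: e_def pair_graph_no_loop[OF G])
  have deg: "(\<Sum>l<?N. e i l) = of_nat k"
    using sum_indicator_nth[OF dist, of "\<lambda>w. (vs ! i, w) \<in> parcs G" "1 :: complex poly"]
      card_out_neighbours[OF srg iv] by (simp add: e_def set)
  have "(\<Sum>l<?N. e i l * e l j) =
    (\<Sum>l<?N. if (vs ! i, vs ! l) \<in> parcs G \<and> (vs ! j, vs ! l) \<in> parcs G then 1 else 0)"
    by (rule sum.cong) (auto simp: e_def pair_graph_arc_commute[OF G, of "vs ! j"])
  also have "\<dots> = of_nat (card (common_neighbours G (vs ! i) (vs ! j)))"
    using sum_indicator_nth[OF dist, of "\<lambda>w. (vs ! i, w) \<in> parcs G \<and> (vs ! j, w) \<in> parcs G"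
        "1 :: complex poly"] by (simp add: common_neighbours_def set)
  also have "\<dots> =
    (if i = j then of_nat k else if (vs ! i, vs ! j) \<in> parcs G then of_nat a else of_nat c)"
  proof (cases "i = j")
    case True
    then show ?thesis using card_out_neighbours[OF srg iv] by (simp add: common_neighbours_def)
  next
    case False
    then have "vs ! i \<noteq> vs ! j" using dist i j by (simp add: nth_eq_iff_index_eq)
    then show ?thesis using srg iv jv False by (simp add: strongly_regular_def)
  qed
  finally have sq: "(\<Sum>l<?N. e i l * e l j) =
    (if i = j then of_nat k else if (vs ! i, vs ! j) \<in> parcs G then of_nat a else of_nat c)" .
  have K: "char_poly_matrix (adjacency_mat G vs) $$ (i, l) = (if i = l then x else 0) - e i l"
    if "l < ?N" for l
    using i that by (simp add: char_poly_matrix_def adjacency_mat_def x_def e_def one_pCons)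
  have M: "resolvent_numer k a c G vs $$ (l, j) = (if l = j then \<alpha> else 0) + \<beta> * e l j + \<gamma>"
    if "l < ?N" for l
    using j that by (simp add: resolvent_numer_def \<alpha>_def \<beta>_def \<gamma>_def e_def)
  have cK: "char_poly_matrix (adjacency_mat G vs) \<in> carrier_mat ?N ?N"
    and cM: "resolvent_numer k a c G vs \<in> carrier_mat ?N ?N"
    by (simp_all add: char_poly_matrix_closed[OF adjacency_mat_carrier] resolvent_numer_def)
  have "(char_poly_matrix (adjacency_mat G vs) * resolvent_numer k a c G vs) $$ (i, j) =
    (\<Sum>l<?N. char_poly_matrix (adjacency_mat G vs) $$ (i, l) *
      resolvent_numer k a c G vs $$ (l, j))"
    using i j carrier_matD[OF cK] carrier_matD[OF cM]
    by (simp add: scalar_prod_def lessThan_atLeast0)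
  also have "\<dots> =
    (\<Sum>l<?N. ((if i = l then x else 0) - e i l) * ((if l = j then \<alpha> else 0) + \<beta> * e l j + \<gamma>))"
    by (rule sum.cong) (simp_all add: K M)
  \<comment> \<open>Collect the diagonal terms so that only the sums known from \<open>sq\<close> and \<open>deg\<close> remain.\<close>
  also have "\<dots> = (\<Sum>l<?N. (if i = l then x * ((if i = j then \<alpha> else 0) + \<beta> * e i j + \<gamma>) else 0)
      - (if l = j then \<alpha> * e i j else 0) - \<beta> * (e i l * e l j) - \<gamma> * e i l)"
    by (rule sum.cong) (auto simp: algebra_simps)
  also have "\<dots> = x * ((if i = j then \<alpha> else 0) + \<beta> * e i j + \<gamma>) - \<alpha> * e i j
      - \<beta> * (\<Sum>l<?N. e i l * e l j) - \<gamma> * (\<Sum>l<?N. e i l)"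
    using i j by (simp add: sum_subtractf sum_distrib_left)
  also have "\<dots> = (if i = j then resolvent_denom k a c else 0)"
    unfolding sq deg coeffs using no_loop[of i]
    by (auto simp: e_def \<gamma>_def algebra_simps)
  finally show "(char_poly_matrix (adjacency_mat G vs) * resolvent_numer k a c G vs) $$ (i, j) =
    (resolvent_denom k a c \<cdot>\<^sub>m 1\<^sub>m ?N) $$ (i, j)" using i j by simp
qed (auto simp: char_poly_matrix_def adjacency_mat_def resolvent_numer_def)

section \<open>Changing the adjacency of one pair of vertices\<close>

text \<open>
  The factors by which the two characteristic polynomials change are equal because the leading
  \<open>2 \<times> 2\<close> blocks of the two resolvents are: their diagonal entries belong to single vertices, their
  off-diagonal ones to pairs that are both adjacent or both non-adjacent.
\<close>

lemma char_poly_pair_perturbation_eq: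
  fixes S :: "complex mat"
  assumes srg: "strongly_regular n k a c G"
    and enum: "vertex_enum G (u # v # ws)" "vertex_enum G (u' # v' # ws')"
    and adj: "(u, v) \<in> parcs G \<longleftrightarrow> (u', v') \<in> parcs G"
    and S: "S \<in> carrier_mat 2 2" and r: "length ws = r" "length ws' = r"
  shows "char_poly (adjacency_mat G (u # v # ws) + four_block_mat S (0\<^sub>m 2 r) (0\<^sub>m r 2) (0\<^sub>m r r)) =
         char_poly (adjacency_mat G (u' # v' # ws') + four_block_mat S (0\<^sub>m 2 r) (0\<^sub>m r 2) (0\<^sub>m r r))"
    (is "char_poly (?A + ?S) = char_poly (?A' + ?S)")
proof -
  have G: "pair_graph G" using srg by (simp add: strongly_regular_def)
  define d where "d = resolvent_denom k a c"
  define M where "M = resolvent_numer k a c G (u # v # ws)"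
  define M' where "M' = resolvent_numer k a c G (u' # v' # ws')"
  have c: "?A \<in> carrier_mat (2 + r) (2 + r)" "M \<in> carrier_mat (2 + r) (2 + r)"
    "?A' \<in> carrier_mat (2 + r) (2 + r)" "M' \<in> carrier_mat (2 + r) (2 + r)"
    using r by (simp_all add: adjacency_mat_def M_def M'_def resolvent_numer_def)
  have inv: "char_poly_matrix ?A * M = d \<cdot>\<^sub>m 1\<^sub>m (2 + r)"
    "char_poly_matrix ?A' * M' = d \<cdot>\<^sub>m 1\<^sub>m (2 + r)"
    using char_poly_matrix_times_resolvent_numer[OF srg enum(1)]
      char_poly_matrix_times_resolvent_numer[OF srg enum(2)] r
    by (simp_all add: d_def M_def M'_def)
  have corner: "mat 2 2 (\<lambda>ij. M $$ ij) = mat 2 2 (\<lambda>ij. M' $$ ij)"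
    using adj by (intro eq_matI)
      (auto simp: M_def M'_def resolvent_numer_def less_2_cases_iff pair_graph_no_loop[OF G]
        pair_graph_arc_commute[OF G, of v u] pair_graph_arc_commute[OF G, of v' u'])
  have same: "char_poly ?A = char_poly ?A'"
    by (rule char_poly_similar[OF similar_adjacency_mat[OF enum]])
  have "d ^ (2 + r) * char_poly (?A + ?S) = d ^ (2 + r) * char_poly (?A' + ?S)"
    unfolding char_poly_corner_perturbation[OF c(1) S c(2) inv(1)]
      char_poly_corner_perturbation[OF c(3) S c(4) inv(2)] corner same ..
  then show ?thesis using resolvent_denom_nonzero[of k a c] by (simp add: d_def)
qed

lemma vertex_enum_starting_with:
  assumes "pair_graph G" "u \<in> pverts G" "v \<in> pverts G" "u \<noteq> v"
  obtains ws where "vertex_enum G (u # v # ws)" "length ws = card (pverts G) - 2"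
proof -
  interpret pair_graph G by fact
  obtain ws where ws: "set ws = pverts G - {u, v}" "distinct ws"
    using finite_distinct_list[of "pverts G - {u, v}"] by auto
  show thesis
  proof (rule that)
    show "vertex_enum G (u # v # ws)" using ws assms by (auto simp: vertex_enum_def)
    show "length ws = card (pverts G) - 2"
      using ws assms by (simp add: distinct_card[symmetric] card_Diff_subset)
  qed
qed

definition swap_mat :: "complex mat" where
  "swap_mat = mat 2 2 (\<lambda>(i, j). if i = j then 0 else 1)"

text \<open>
  Deletion and addition of an edge are the cases \<open>t = - 1\<close> and \<open>t = 1\<close> of adding \<open>t\<close> to the
  adjacency indicator of the unordered pair \<open>{u, v}\<close>, so that one argument serves both.
\<close>

definition pair_shift ::
    "complex \<Rightarrow> 'a \<Rightarrow> 'a \<Rightarrow> 'a pair_pre_digraph \<Rightarrow> 'a pair_pre_digraph \<Rightarrow> bool" where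
  "pair_shift t u v G H \<longleftrightarrow> pverts H = pverts G \<and>
     (\<forall>x y. of_bool ((x, y) \<in> parcs H) =
        of_bool ((x, y) \<in> parcs G) + (if {x, y} = {u, v} then t else 0))"

lemma pair_shift_delete_edge:
  assumes "pair_graph G" "(u, v) \<in> parcs G"
  shows "pair_shift (- 1) u v G (delete_edge u v G)"
  using assms pair_graph_arc_commute[OF assms(1), of v u]
  by (auto simp: pair_shift_def delete_edge_def doubleton_eq_iff)

lemma pair_shift_add_edge:
  assumes "pair_graph G" "(u, v) \<notin> parcs G"
  shows "pair_shift 1 u v G (add_edge u v G)"
  using assms pair_graph_arc_commute[OF assms(1), of v u]
  by (auto simp: pair_shift_def add_edge_def doubleton_eq_iff)

lemma adjacency_mat_pair_shift:
  assumes shift: "pair_shift t u v G H" and dist: "distinct (u # v # ws)" and r: "length ws = r"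
  shows "adjacency_mat H (u # v # ws) = adjacency_mat G (u # v # ws) +
    four_block_mat (t \<cdot>\<^sub>m swap_mat) (0\<^sub>m 2 r) (0\<^sub>m r 2) (0\<^sub>m r r)"
    (is "_ = _ + ?B")
proof (rule eq_matI)
  let ?vs = "u # v # ws"
  fix i j
  assume "i < dim_row (adjacency_mat G ?vs + ?B)" "j < dim_col (adjacency_mat G ?vs + ?B)"
  then have i: "i < length ?vs" and j: "j < length ?vs"
    using r by (simp_all add: swap_mat_def)
  have first: "?vs ! l = u \<longleftrightarrow> l = 0" "?vs ! l = v \<longleftrightarrow> l = 1" if "l < length ?vs" for l
    using nth_eq_iff_index_eq[OF dist that, of 0] nth_eq_iff_index_eq[OF dist that, of 1]
    by simp_all
  have "{?vs ! i, ?vs ! j} = {u, v} \<longleftrightarrow> i < 2 \<and> j < 2 \<and> i \<noteq> j"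
    unfolding doubleton_eq_iff first[OF i] first[OF j] by auto
  moreover have "adjacency_mat F ?vs $$ (i, j) = of_bool ((?vs ! i, ?vs ! j) \<in> parcs F)" for F
    using i j by (simp add: adjacency_mat_def)
  moreover have "?B $$ (i, j) = (if i < 2 \<and> j < 2 \<and> i \<noteq> j then t else 0)"
    using i j r by (auto simp: swap_mat_def)
  ultimately show "adjacency_mat H ?vs $$ (i, j) = (adjacency_mat G ?vs + ?B) $$ (i, j)"
    using shift i j r by (simp add: pair_shift_def swap_mat_def)
qed (use r in \<open>simp_all add: adjacency_mat_def swap_mat_def\<close>)

lemma graph_eigenvalues_pair_shift_eq:
  assumes srg: "strongly_regular n k a c G"
    and V: "u \<in> pverts G" "v \<in> pverts G" "u \<noteq> v" "u' \<in> pverts G" "v' \<in> pverts G" "u' \<noteq> v'"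
    and adj: "(u, v) \<in> parcs G \<longleftrightarrow> (u', v') \<in> parcs G"
    and shift: "pair_shift t u v G H" "pair_shift t u' v' G H'"
  shows "graph_eigenvalues H = graph_eigenvalues H'"
proof -
  have G: "pair_graph G" using srg by (simp add: strongly_regular_def)
  obtain ws where ws: "vertex_enum G (u # v # ws)" "length ws = card (pverts G) - 2"
    using vertex_enum_starting_with[OF G V(1-3)] .
  obtain ws' where ws': "vertex_enum G (u' # v' # ws')" "length ws' = card (pverts G) - 2"
    using vertex_enum_starting_with[OF G V(4-6)] .
  have dist: "distinct (u # v # ws)" "distinct (u' # v' # ws')"
    using ws(1) ws'(1) by (simp_all add: vertex_enum_def)
  have "char_poly (adjacency_mat H (u # v # ws)) = char_poly (adjacency_mat H' (u' # v' # ws'))"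
    unfolding adjacency_mat_pair_shift[OF shift(1) dist(1) ws(2)]
      adjacency_mat_pair_shift[OF shift(2) dist(2) ws'(2)]
    by (rule char_poly_pair_perturbation_eq[OF srg ws(1) ws'(1) adj _ ws(2) ws'(2)])
       (simp add: swap_mat_def)
  moreover have "vertex_enum H (u # v # ws)" "vertex_enum H' (u' # v' # ws')"
    using ws(1) ws'(1) shift by (simp_all add: vertex_enum_def pair_shift_def)
  ultimately show ?thesis by (simp add: graph_eigenvalues_eq)
qed

theorem corollary10:
  fixes X :: "'a pair_pre_digraph" and n k a c :: nat
  assumes "strongly_regular n k a c X"
  shows "(\<forall>u v u' v'. (u, v) \<in> parcs X \<longrightarrow> (u', v') \<in> parcs X \<longrightarrow>
            graph_eigenvalues (delete_edge u v X) = graph_eigenvalues (delete_edge u' v' X)) \<and>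
         (\<forall>u \<in> pverts X. \<forall>v \<in> pverts X. \<forall>u' \<in> pverts X. \<forall>v' \<in> pverts X.
            u \<noteq> v \<longrightarrow> (u, v) \<notin> parcs X \<longrightarrow> u' \<noteq> v' \<longrightarrow> (u', v') \<notin> parcs X \<longrightarrow>
            graph_eigenvalues (add_edge u v X) = graph_eigenvalues (add_edge u' v' X))"
proof (intro conjI allI ballI impI)
  have G: "pair_graph X" using assms by (simp add: strongly_regular_def)
  interpret pair_graph X by (rule G)
  fix u v u' v'
  {
    assume e: "(u, v) \<in> parcs X" "(u', v') \<in> parcs X"
    then have "u \<in> pverts X" "v \<in> pverts X" "u \<noteq> v" "u' \<in> pverts X" "v' \<in> pverts X" "u' \<noteq> v'"
      by (auto dest: in_arcsD1 in_arcsD2 simp: pair_graph_no_loop[OF G])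
    then show "graph_eigenvalues (delete_edge u v X) = graph_eigenvalues (delete_edge u' v' X)"
      using e by (intro graph_eigenvalues_pair_shift_eq[OF assms _ _ _ _ _ _ _
            pair_shift_delete_edge[OF G e(1)] pair_shift_delete_edge[OF G e(2)]]) simp_all
  }
  {
    assume V: "u \<in> pverts X" "v \<in> pverts X" "u \<noteq> v" "u' \<in> pverts X" "v' \<in> pverts X" "u' \<noteq> v'"
      and e: "(u, v) \<notin> parcs X" "(u', v') \<notin> parcs X"
    then show "graph_eigenvalues (add_edge u v X) = graph_eigenvalues (add_edge u' v' X)"
      by (intro graph_eigenvalues_pair_shift_eq[OF assms V _
            pair_shift_add_edge[OF G e(1)] pair_shift_add_edge[OF G e(2)]]) simp
  }
qed

end
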